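(* Let $\mathcal{H},\bar{\mathcal{H}}$ be graded connected Hopf algebras over $\mathbb{R}$ (with finite-dimensional graded pieces) with bases $\mathcal{B}=\amalg_n\mathcal{B}_n$, $\bar{\mathcal{B}}=\amalg_n\bar{\mathcal{B}}_n$ respectively. Suppose in addition that $\mathcal{B}$ is a state space basis. If $\theta:\mathcal{H}\to\bar{\mathcal{H}}$ is a Hopf-morphism such that $\theta(\mathcal{B}_n)=\bar{\mathcal{B}}_n$ (as sets) for some $n$, and $\theta(\mathcal{B}_1)\subseteq\bar{\mathcal{B}}_1$, then the $a$th Hopf-power Markov chain on $\bar{\mathcal{B}}_n$ is the projection via $\theta$ of the $a$th Hopf-power Markov chain on $\mathcal{B}_n$; that is, writing $\check K$ and $\check{\bar K}$ for the respective transition matrices, $$\sum_{y\in\mathcal{B}_n:\ \theta(y)=\bar y}\check K(x,y)=\check{\bar K}(\theta(x),\bar y)\qquad\text{for all }x\in\mathcal{B}_n,\ \bar y\in\bar{\mathcal{B}}_n.$$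
   Context: A graded connected Hopf algebra over $\mathbb{R}$ is $\mathcal{H}=\bigoplus_{n\ge0}\mathcal{H}_n$ with $\mathcal{H}_0=\mathbb{R}\cdot1$, an associative unital product $\mathcal{H}_i\otimes\mathcal{H}_j\to\mathcal{H}_{i+j}$ and a coassociative coproduct $\Delta:\mathcal{H}_n\to\bigoplus_{j=0}^n\mathcal{H}_j\otimes\mathcal{H}_{n-j}$ with $\Delta(x)-1\otimes x-x\otimes1\in\bigoplus_{j=1}^{n-1}\mathcal{H}_j\otimes\mathcal{H}_{n-j}$ for $x\in\mathcal{H}_n$ ($n\ge1$), $\Delta(1)=1\otimes1$, and $\Delta(wz)=\Delta(w)\Delta(z)$. $\Psi^a:=m^{[a]}\Delta^{[a]}$ is the $a$-fold coproduct followed by the $a$-fold product. A Hopf-morphism is a linear map $\theta$ with $\theta(1)=1$, $\deg\theta(x)=\deg x$ (degree-preserving), $\theta(w)\theta(z)=\theta(wz)$ and $\Delta(\theta(x))=(\theta\otimes\theta)(\Delta(x))$. For a basis $\mathcal{B}=\amalg_n\mathcal{B}_n$ ($\mathcal{B}_n$ a basis of $\mathcal{H}_n$, $\mathcal{B}_0=\{1\}$), structure constants are defined by $z_1\cdots z_a=\sum_{y\in\mathcal{B}}\xi^y_{z_1,\dots,z_a}y$ and $\Delta^{[a]}(x)=\sum_{z_1,\dots,z_a\in\mathcal{B}}\eta_x^{z_1,\dots,z_a}z_1\otimes\cdots\otimes z_a$. $\mathcal{B}$ is a state space basis if all $\xi^y_{w,z}\ge0$, all $\eta_x^{w,z}\ge0$,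 and no $x\in\mathcal{B}$ with $\deg x>1$ satisfies $\Delta(x)=1\otimes x+x\otimes1$. The rescaling function is $\eta(x):=\sum_{c_1,\dots,c_n\in\mathcal{B}_1}\eta_x^{c_1,\dots,c_n}$ for $x\in\mathcal{B}_n$. The $a$th Hopf-power Markov chain on $\mathcal{B}_n$ has transition matrix $\check K$ defined by $a^{-n}\Psi^a(x)=\sum_{y\in\mathcal{B}_n}\frac{\eta(x)}{\eta(y)}\check K(x,y)\,y$ for $x\in\mathcal{B}_n$; the chain on $\bar{\mathcal{B}}_n$ is defined by the same formulas in $\bar{\mathcal{H}}$ with respect to $\bar{\mathcal{B}}$. *)

theory Defs
  imports "HOL-Analysis.Finite_Function_Topology"
begin

section \<open>Tensor powers of a real vector space\<close>

text \<open>
  The type \<open>'a tensors\<close> is the direct sum over all \<open>k \<ge> 0\<close> of the tensor powers of the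
  real vector space \<open>'a\<close>: finite formal real combinations of lists (pure tensors), modulo
  multilinearity in the entries. The \<open>k\<close>-th tensor power is spanned by the classes of the
  lists of length \<open>k\<close>. A single type for all \<open>k\<close> is used because the iterated coproducts
  take values in tensor powers of varying order.
\<close>

definition tensor_relations :: "('a::real_vector list, real) poly_mapping set" where
  "tensor_relations =
     {Poly_Mapping.single (xs @ (x + y) # ys) 1 - Poly_Mapping.single (xs @ x # ys) 1
        - Poly_Mapping.single (xs @ y # ys) 1 | xs ys x y. True}
   \<union> {Poly_Mapping.single (xs @ (c *\<^sub>R x) # ys) 1
        - c *\<^sub>R Poly_Mapping.single (xs @ x # ys) 1 | xs ys c x. True}"

quotient_type (overloaded) 'a tensors = "('a::real_vector list, real) poly_mapping" /
  "\<lambda>p q. p - q \<in> span tensor_relations"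
proof (rule equivpI)
  show "reflp (\<lambda>p q :: ('a list, real) poly_mapping. p - q \<in> span tensor_relations)"
    by (auto simp: reflp_def span_zero)
  show "symp (\<lambda>p q :: ('a list, real) poly_mapping. p - q \<in> span tensor_relations)"
    unfolding symp_def by (metis minus_diff_eq span_neg)
  show "transp (\<lambda>p q :: ('a list, real) poly_mapping. p - q \<in> span tensor_relations)"
    unfolding transp_def
  proof (intro allI impI)
    fix p q r :: "('a list, real) poly_mapping"
    assume "p - q \<in> span tensor_relations" "q - r \<in> span tensor_relations"
    then have "(p - q) + (q - r) \<in> span tensor_relations" by (rule span_add)
    then show "p - r \<in> span tensor_relations" by simp
  qed
qed

instantiation tensors :: (real_vector) real_vector
begin

lift_definition zero_tensors :: "'a tensors" is 0 .

lift_definition plus_tensors :: "'a tensors \<Rightarrow> 'a tensors \<Rightarrow> 'a tensors" is "(+)"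
proof -
  fix p p' q q' :: "('a list, real) poly_mapping"
  assume "p - p' \<in> span tensor_relations" "q - q' \<in> span tensor_relations"
  then have "(p - p') + (q - q') \<in> span tensor_relations" by (rule span_add)
  then show "(p + q) - (p' + q') \<in> span tensor_relations" by (simp add: algebra_simps)
qed

lift_definition uminus_tensors :: "'a tensors \<Rightarrow> 'a tensors" is uminus
proof -
  fix p p' :: "('a list, real) poly_mapping"
  assume "p - p' \<in> span tensor_relations"
  then have "- (p - p') \<in> span tensor_relations" by (rule span_neg)
  then show "- p - - p' \<in> span tensor_relations" by simp
qed

lift_definition minus_tensors :: "'a tensors \<Rightarrow> 'a tensors \<Rightarrow> 'a tensors" is "(-)"
proof -
  fix p p' q q' :: "('a list, real) poly_mapping"
  assume "p - p' \<in> span tensor_relations" "q - q' \<in> span tensor_relations"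
  then have "(p - p') - (q - q') \<in> span tensor_relations" by (rule span_diff)
  then show "(p - q) - (p' - q') \<in> span tensor_relations" by (simp add: algebra_simps)
qed

lift_definition scaleR_tensors :: "real \<Rightarrow> 'a tensors \<Rightarrow> 'a tensors" is scaleR
proof -
  fix c :: real and p p' :: "('a list, real) poly_mapping"
  assume "p - p' \<in> span tensor_relations"
  then have "c *\<^sub>R (p - p') \<in> span tensor_relations" by (rule span_scale)
  then show "c *\<^sub>R p - c *\<^sub>R p' \<in> span tensor_relations" by (simp add: scaleR_diff_right)
qed

instance
proof
  fix s t u :: "'a tensors" and c d :: real
  have eqI: "p - q \<in> span tensor_relations" if "p = q" for p q :: "('a list, real) poly_mapping"
    using that by (simp add: span_zero)
  show "s + t + u = s + (t + u)" by transfer (rule eqI, rule add.assoc)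
  show "s + t = t + s" by transfer (rule eqI, rule add.commute)
  show "0 + s = s" by transfer (rule eqI, rule add_0_left)
  show "- s + s = 0" by transfer (rule eqI, rule left_minus)
  show "s - t = s + - t" by transfer (rule eqI, rule diff_conv_add_uminus)
  show "c *\<^sub>R (s + t) = c *\<^sub>R s + c *\<^sub>R t" by transfer (rule eqI, rule scaleR_add_right)
  show "(c + d) *\<^sub>R s = c *\<^sub>R s + d *\<^sub>R s" by transfer (rule eqI, rule scaleR_add_left)
  show "c *\<^sub>R d *\<^sub>R s = (c * d) *\<^sub>R s" by transfer (rule eqI, rule scaleR_scaleR)
  show "1 *\<^sub>R s = s" by transfer (rule eqI, rule scaleR_one)
qed

end

lift_definition tensor :: "'a::real_vector list \<Rightarrow> 'a tensors"
  is "\<lambda>xs. Poly_Mapping.single xs 1" .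

definition multilinear_list :: "('a::real_vector list \<Rightarrow> 'b::real_vector) \<Rightarrow> bool" where
  "multilinear_list f \<longleftrightarrow> (\<forall>xs ys. linear (\<lambda>x. f (xs @ x # ys)))"

text \<open>
  For multilinear \<open>f\<close>, \<open>tens_lift f\<close> is the linear map with \<open>tens_lift f (tensor xs) = f xs\<close>
  (universal property, proved below). The definition evaluates \<open>f\<close> on a representative; it is
  only meant for multilinear \<open>f\<close> (in the maps below: for linear \<open>\<theta>\<close> and \<open>D\<close>).
\<close>

definition tens_lift :: "('a::real_vector list \<Rightarrow> 'b::real_vector) \<Rightarrow> 'a tensors \<Rightarrow> 'b" where
  "tens_lift f t =
     (\<Sum>xs\<in>Poly_Mapping.keys (rep_tensors t). Poly_Mapping.lookup (rep_tensors t) xs *\<^sub>R f xs)"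

lemma multilinear_tensor: "multilinear_list tensor"
  unfolding multilinear_list_def
proof (intro allI linearI)
  fix xs ys :: "'a list" and x y :: 'a and c :: real
  have "Poly_Mapping.single (xs @ (x + y) # ys) 1 - Poly_Mapping.single (xs @ x # ys) 1
        - Poly_Mapping.single (xs @ y # ys) 1 \<in> (tensor_relations :: ('a list, real) poly_mapping set)"
    unfolding tensor_relations_def by blast
  then show "tensor (xs @ (x + y) # ys) = tensor (xs @ x # ys) + tensor (xs @ y # ys)"
    unfolding tensor.abs_eq plus_tensors.abs_eq tensors.abs_eq_iff
    by (simp only: diff_diff_eq span_base)
  have "Poly_Mapping.single (xs @ (c *\<^sub>R x) # ys) 1
        - c *\<^sub>R Poly_Mapping.single (xs @ x # ys) 1 \<in> (tensor_relations :: ('a list, real) poly_mapping set)"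
    unfolding tensor_relations_def by blast
  then show "tensor (xs @ (c *\<^sub>R x) # ys) = c *\<^sub>R tensor (xs @ x # ys)"
    unfolding tensor.abs_eq scaleR_tensors.abs_eq tensors.abs_eq_iff
    by (rule span_base)
qed

context
  fixes f :: "'a::real_vector list \<Rightarrow> 'b::real_vector"
begin

private definition ev :: "('a list, real) poly_mapping \<Rightarrow> 'b" where
  "ev p = (\<Sum>xs\<in>Poly_Mapping.keys p. Poly_Mapping.lookup p xs *\<^sub>R f xs)"

private lemma ev_superset:
  assumes "finite S" "Poly_Mapping.keys p \<subseteq> S"
  shows "ev p = (\<Sum>xs\<in>S. Poly_Mapping.lookup p xs *\<^sub>R f xs)"
  unfolding ev_def using assms by (intro sum.mono_neutral_left) (auto simp: in_keys_iff)

private lemma lookup_scaleR_real: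
  "Poly_Mapping.lookup (c *\<^sub>R p) xs = c * Poly_Mapping.lookup (p :: ('a list, real) poly_mapping) xs"
  by (simp add: scaleR_poly_mapping_def)

private lemma linear_ev: "linear ev"
proof (rule linearI)
  fix p q :: "('a list, real) poly_mapping" and c :: real
  let ?S = "Poly_Mapping.keys p \<union> Poly_Mapping.keys q"
  have "ev (p + q) = (\<Sum>xs\<in>?S. Poly_Mapping.lookup (p + q) xs *\<^sub>R f xs)"
    using keys_add[of p q] by (intro ev_superset) auto
  also have "\<dots> = (\<Sum>xs\<in>?S. Poly_Mapping.lookup p xs *\<^sub>R f xs)
      + (\<Sum>xs\<in>?S. Poly_Mapping.lookup q xs *\<^sub>R f xs)"
    by (simp add: lookup_add scaleR_add_left sum.distrib)
  also have "\<dots> = ev p + ev q"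
    using ev_superset[of ?S p] ev_superset[of ?S q] by simp
  finally show "ev (p + q) = ev p + ev q" .
  have "ev (c *\<^sub>R p) = (\<Sum>xs\<in>Poly_Mapping.keys p. Poly_Mapping.lookup (c *\<^sub>R p) xs *\<^sub>R f xs)"
    by (intro ev_superset) (auto simp: in_keys_iff lookup_scaleR_real)
  then show "ev (c *\<^sub>R p) = c *\<^sub>R ev p"
    by (simp add: lookup_scaleR_real scaleR_sum_right ev_def)
qed

private lemma ev_single: "ev (Poly_Mapping.single xs 1) = f xs"
  by (simp add: ev_def)

private lemma ev_cong:
  assumes f: "multilinear_list f" and "p - q \<in> span tensor_relations"
  shows "ev p = ev q"
proof -
  have l: "linear (\<lambda>x. f (xs @ x # ys))" for xs ys
    using f unfolding multilinear_list_def by blast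
  have add: "f (xs @ (x + y) # ys) = f (xs @ x # ys) + f (xs @ y # ys)" for xs ys x y
    using linear_add[OF l] .
  have scaleR: "f (xs @ (c *\<^sub>R x) # ys) = c *\<^sub>R f (xs @ x # ys)" for xs ys c x
    using linear_cmul[OF l] .
  have "ev r = 0" if r: "r \<in> tensor_relations" for r
    using r unfolding tensor_relations_def Un_iff
  proof (elim disjE CollectE exE conjE)
    fix xs ys x y
    assume r: "r = Poly_Mapping.single (xs @ (x + y) # ys) 1
      - Poly_Mapping.single (xs @ x # ys) 1 - Poly_Mapping.single (xs @ y # ys) 1"
    show "ev r = 0"
      unfolding r linear_diff[OF linear_ev] ev_single add by simp
  next
    fix xs ys c x
    assume r: "r = Poly_Mapping.single (xs @ (c *\<^sub>R x) # ys) 1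
      - c *\<^sub>R Poly_Mapping.single (xs @ x # ys) 1"
    show "ev r = 0"
      unfolding r linear_diff[OF linear_ev] linear_cmul[OF linear_ev] ev_single scaleR by simp
  qed
  then have "ev (p - q) = 0"
    using assms(2) linear_eq_0_on_span[OF linear_ev] by blast
  then show ?thesis unfolding linear_diff[OF linear_ev] by simp
qed

private lemma tens_lift_abs:
  assumes "multilinear_list f"
  shows "tens_lift f (abs_tensors p) = ev p"
proof -
  have "abs_tensors (rep_tensors (abs_tensors p)) = abs_tensors p"
    by (rule Quotient3_abs_rep[OF Quotient3_tensors])
  then have "rep_tensors (abs_tensors p) - p \<in> span tensor_relations"
    by (simp only: tensors.abs_eq_iff)
  then show ?thesis
    using ev_cong[OF assms] unfolding tens_lift_def ev_def by blast
qed

lemma tens_lift_tensor: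
  assumes "multilinear_list f"
  shows "tens_lift f (tensor xs) = f xs"
  using tens_lift_abs[OF assms, of "Poly_Mapping.single xs 1"]
  by (simp add: tensor.abs_eq ev_single)

lemma linear_tens_lift:
  assumes "multilinear_list f"
  shows "linear (tens_lift f)"
proof (rule linearI)
  fix s t :: "'a tensors" and c :: real
  obtain p q where [simp]: "s = abs_tensors p" "t = abs_tensors q"
    by (metis Quotient3_abs_rep[OF Quotient3_tensors])
  show "tens_lift f (s + t) = tens_lift f s + tens_lift f t"
    by (simp add: plus_tensors.abs_eq tens_lift_abs[OF assms] linear_add[OF linear_ev])
  show "tens_lift f (c *\<^sub>R s) = c *\<^sub>R tens_lift f s"
    by (simp add: scaleR_tensors.abs_eq tens_lift_abs[OF assms] linear_cmul[OF linear_ev])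
qed

end

text \<open>\<open>\<theta> \<otimes> \<dots> \<otimes> \<theta>\<close> on every tensor power:\<close>

definition tens_map :: "('a::real_vector \<Rightarrow> 'b::real_vector) \<Rightarrow> 'a tensors \<Rightarrow> 'b tensors" where
  "tens_map \<theta> = tens_lift (\<lambda>xs. tensor (map \<theta> xs))"

text \<open>
  The product \<open>(w\<^sub>1 \<otimes> \<dots> \<otimes> w\<^sub>k)(z\<^sub>1 \<otimes> \<dots> \<otimes> z\<^sub>k) = w\<^sub>1 z\<^sub>1 \<otimes> \<dots> \<otimes> w\<^sub>k z\<^sub>k\<close> of the algebra
  on the \<open>k\<close>-th tensor power, extended by 0 to pairs of tensors of different orders.
\<close>

definition tens_mult :: "'a::real_algebra_1 tensors \<Rightarrow> 'a tensors \<Rightarrow> 'a tensors" where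
  "tens_mult s t =
     tens_lift (\<lambda>xs. tens_lift (\<lambda>ys.
       if length xs = length ys then tensor (map2 (\<lambda>x y. x * y) xs ys) else 0) t) s"

definition tens_prod :: "'a::real_algebra_1 tensors \<Rightarrow> 'a" where
  "tens_prod = tens_lift prod_list"

text \<open>
  For a coproduct \<open>D\<close>, the maps \<open>D \<otimes> \<iota> \<otimes> \<dots> \<otimes> \<iota>\<close> and \<open>\<iota> \<otimes> \<dots> \<otimes> \<iota> \<otimes> D\<close>
  (meant for tensors of positive order):
\<close>

definition tens_apply_first ::
    "('a::real_vector \<Rightarrow> 'a tensors) \<Rightarrow> 'a tensors \<Rightarrow> 'a tensors" where
  "tens_apply_first D = tens_lift (\<lambda>xs. if xs = [] then 0 else
     tens_lift (\<lambda>ys. tensor (ys @ tl xs)) (D (hd xs)))"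

definition tens_apply_last ::
    "('a::real_vector \<Rightarrow> 'a tensors) \<Rightarrow> 'a tensors \<Rightarrow> 'a tensors" where
  "tens_apply_last D = tens_lift (\<lambda>xs. if xs = [] then 0 else
     tens_lift (\<lambda>ys. tensor (butlast xs @ ys)) (D (last xs)))"

definition tens_sub :: "'a::real_vector set \<Rightarrow> 'a set \<Rightarrow> 'a tensors set" where
  "tens_sub V W = span {tensor [v, w] | v w. v \<in> V \<and> w \<in> W}"


section \<open>Graded connected Hopf algebras\<close>

definition homogeneous_decomp ::
    "(nat \<Rightarrow> 'a::real_vector set) \<Rightarrow> 'a \<Rightarrow> (nat \<Rightarrow> 'a) \<Rightarrow> bool" where
  "homogeneous_decomp H x f \<longleftrightarrow>
     (\<forall>n. f n \<in> H n) \<and> finite {n. f n \<noteq> 0} \<and> x = (\<Sum>n | f n \<noteq> 0. f n)"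

locale graded_connected_hopf_algebra =
  fixes H :: "nat \<Rightarrow> 'a::real_algebra_1 set"
    and D :: "'a \<Rightarrow> 'a tensors"
  assumes subspace_H: "subspace (H n)"
    and direct_sum: "\<exists>!f. homogeneous_decomp H x f"
    and connected: "H 0 = span {1}"
    and mult_H: "\<lbrakk>w \<in> H i; z \<in> H j\<rbrakk> \<Longrightarrow> w * z \<in> H (i + j)"
    and linear_D: "linear D"
    and D_graded: "x \<in> H n \<Longrightarrow> D x \<in> span (\<Union>j\<in>{0..n}. tens_sub (H j) (H (n - j)))"
    and D_reduced: "\<lbrakk>n \<ge> 1; x \<in> H n\<rbrakk> \<Longrightarrow>
          D x - tensor [1, x] - tensor [x, 1]
            \<in> span (\<Union>j\<in>{1..n - 1}. tens_sub (H j) (H (n - j)))"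
    and D_one: "D 1 = tensor [1, 1]"
    and D_mult: "D (w * z) = tens_mult (D w) (D z)"
    and coassoc: "tens_apply_first D (D x) = tens_apply_last D (D x)"

definition finite_dim_pieces :: "(nat \<Rightarrow> 'a::real_vector set) \<Rightarrow> bool" where
  "finite_dim_pieces H \<longleftrightarrow> (\<forall>n. \<exists>S. finite S \<and> H n = span S)"

text \<open>The counit: the projection to \<open>H 0 = \<real> \<cdot> 1\<close> along the grading.\<close>

definition counit :: "(nat \<Rightarrow> 'a::real_algebra_1 set) \<Rightarrow> 'a \<Rightarrow> real" where
  "counit H x = (THE r. \<exists>f. homogeneous_decomp H x f \<and> f 0 = r *\<^sub>R 1)"

text \<open>
  \<open>\<Delta>\<^sup>[\<^sup>a\<^sup>]\<close>. The value at \<open>a = 0\<close> (the counit, with values in the zeroth tensor power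
  \<open>\<real> \<cdot> tensor []\<close>) is used only for the rescaling function in degree 0.
\<close>

fun iter_coprod ::
    "(nat \<Rightarrow> 'a::real_algebra_1 set) \<Rightarrow> ('a \<Rightarrow> 'a tensors) \<Rightarrow> nat \<Rightarrow> 'a \<Rightarrow> 'a tensors" where
  "iter_coprod H D 0 x = counit H x *\<^sub>R tensor []"
| "iter_coprod H D (Suc 0) x = tensor [x]"
| "iter_coprod H D (Suc (Suc a)) x = tens_apply_last D (iter_coprod H D (Suc a) x)"

definition hopf_power ::
    "(nat \<Rightarrow> 'a::real_algebra_1 set) \<Rightarrow> ('a \<Rightarrow> 'a tensors) \<Rightarrow> nat \<Rightarrow> 'a \<Rightarrow> 'a" where
  "hopf_power H D a x = tens_prod (iter_coprod H D a x)"

definition hopf_morphism ::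
    "(nat \<Rightarrow> 'a::real_algebra_1 set) \<Rightarrow> ('a \<Rightarrow> 'a tensors) \<Rightarrow>
     (nat \<Rightarrow> 'b::real_algebra_1 set) \<Rightarrow> ('b \<Rightarrow> 'b tensors) \<Rightarrow> ('a \<Rightarrow> 'b) \<Rightarrow> bool" where
  "hopf_morphism H D H' D' \<theta> \<longleftrightarrow>
     linear \<theta> \<and> \<theta> 1 = 1 \<and> (\<forall>n. \<forall>x\<in>H n. \<theta> x \<in> H' n) \<and>
     (\<forall>w z. \<theta> w * \<theta> z = \<theta> (w * z)) \<and> (\<forall>x. D' (\<theta> x) = tens_map \<theta> (D x))"


section \<open>Bases and Hopf-power Markov chains\<close>

definition graded_basis ::
    "(nat \<Rightarrow> 'a::real_algebra_1 set) \<Rightarrow> (nat \<Rightarrow> 'a set) \<Rightarrow> bool" where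
  "graded_basis H B \<longleftrightarrow> B 0 = {1} \<and> (\<forall>n. independent (B n) \<and> span (B n) = H n)"

definition prod_coeff ::
    "(nat \<Rightarrow> 'a::real_algebra_1 set) \<Rightarrow> 'a list \<Rightarrow> 'a \<Rightarrow> real" where
  "prod_coeff B zs y = representation (\<Union>n. B n) (prod_list zs) y"

text \<open>
  \<open>\<eta>\<^sub>x\<close> with upper indices \<open>zs\<close>; the pure tensors with entries in the basis form a basis of
  the direct sum of all tensor powers.
\<close>

definition coprod_coeff ::
    "(nat \<Rightarrow> 'a::real_algebra_1 set) \<Rightarrow> ('a \<Rightarrow> 'a tensors) \<Rightarrow> (nat \<Rightarrow> 'a set) \<Rightarrow>
     'a \<Rightarrow> 'a list \<Rightarrow> real" where
  "coprod_coeff H D B x zs =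
     representation (tensor ` lists (\<Union>n. B n)) (iter_coprod H D (length zs) x) (tensor zs)"

definition state_space_basis ::
    "(nat \<Rightarrow> 'a::real_algebra_1 set) \<Rightarrow> ('a \<Rightarrow> 'a tensors) \<Rightarrow> (nat \<Rightarrow> 'a set) \<Rightarrow> bool" where
  "state_space_basis H D B \<longleftrightarrow>
     graded_basis H B \<and>
     (\<forall>w\<in>(\<Union>n. B n). \<forall>z\<in>(\<Union>n. B n). \<forall>y\<in>(\<Union>n. B n). prod_coeff B [w, z] y \<ge> 0) \<and>
     (\<forall>x\<in>(\<Union>n. B n). \<forall>w\<in>(\<Union>n. B n). \<forall>z\<in>(\<Union>n. B n). coprod_coeff H D B x [w, z] \<ge> 0) \<and>
     (\<forall>n>1. \<forall>x\<in>B n. D x \<noteq> tensor [1, x] + tensor [x, 1])"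

text \<open>The rescaling function on elements \<open>x\<close> of degree \<open>n\<close>:\<close>

definition rescaling ::
    "(nat \<Rightarrow> 'a::real_algebra_1 set) \<Rightarrow> ('a \<Rightarrow> 'a tensors) \<Rightarrow> (nat \<Rightarrow> 'a set) \<Rightarrow>
     nat \<Rightarrow> 'a \<Rightarrow> real" where
  "rescaling H D B n x = (\<Sum>cs | set cs \<subseteq> B 1 \<and> length cs = n. coprod_coeff H D B x cs)"

text \<open>
  The transition matrix of the \<open>a\<close>-th Hopf-power Markov chain on \<open>B n\<close>, extended by 0 outside
  \<open>B n \<times> B n\<close>.
\<close>

definition hopf_power_chain ::
    "(nat \<Rightarrow> 'a::real_algebra_1 set) \<Rightarrow> ('a \<Rightarrow> 'a tensors) \<Rightarrow> (nat \<Rightarrow> 'a set) \<Rightarrow>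
     nat \<Rightarrow> nat \<Rightarrow> 'a \<Rightarrow> 'a \<Rightarrow> real" where
  "hopf_power_chain H D B a n = (THE K.
     (\<forall>x y. x \<notin> B n \<or> y \<notin> B n \<longrightarrow> K x y = 0) \<and>
     (\<forall>x\<in>B n. inverse (real a ^ n) *\<^sub>R hopf_power H D a x =
        (\<Sum>y\<in>B n. (rescaling H D B n x / rescaling H D B n y * K x y) *\<^sub>R y)))"

end

theory Submission
  imports Defs
begin

text \<open>
  Let \<open>e\<close> be the linear functional that sums the degree-one coordinates. Then
  \<open>\<eta>(x) = (e \<otimes> \<dots> \<otimes> e)(\<Delta>\<^sup>[\<^sup>n\<^sup>](x))\<close> is the \<open>n\<close>-th convolution power of \<open>e\<close>. Coassociativity
  makes convolution associative, so on a state space basis, where every element of degree \<open>> 1\<close> has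
  a nonzero (hence positive) reduced coproduct coefficient, \<open>\<eta> > 0\<close> follows by splitting the
  convolution power at that coefficient. As \<open>\<theta>\<close> is graded and maps \<open>B 1\<close> into \<open>B' 1\<close>, it satisfies
  \<open>e' \<circ> \<theta> = e\<close>, so it preserves \<open>\<eta>\<close>; hence \<open>\<eta>' > 0\<close> on \<open>B' n = \<theta> ` B n\<close>, although \<open>B'\<close> need not
  be a state space basis. Since \<open>\<theta>\<close> also commutes with the Hopf powers, comparing coefficients of
  \<open>\<theta>(\<Psi>\<^sup>a(x))\<close> in \<open>B' n\<close> gives the projection identity.
\<close>

section \<open>Linear maps on tensor powers\<close>

text \<open>A representative is a finite combination of single lists, and passing to the quotient is
  linear. Linear maps on \<open>tensors\<close> are therefore determined by their values on pure
  tensors.\<close>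

lemma tensor_in_span_range: "t \<in> span (range tensor)"
proof -
  have tens_sum: "(\<Sum>i\<in>I. c i *\<^sub>R abs_tensors (g i)) = abs_tensors (\<Sum>i\<in>I. c i *\<^sub>R g i)"
    for c :: "'a list \<Rightarrow> real" and g and I
    by (induction I rule: infinite_finite_induct)
      (simp_all add: zero_tensors_def plus_tensors.abs_eq scaleR_tensors.abs_eq)
  define p where "p = rep_tensors t"
  have *: "p = (\<Sum>xs\<in>Poly_Mapping.keys p. Poly_Mapping.lookup p xs *\<^sub>R Poly_Mapping.single xs 1)"
    by (rule poly_mapping_eqI)
      (simp add: lookup_sum scaleR_poly_mapping_def lookup_single when_def
        if_distrib[where f = "\<lambda>z. _ * z"] in_keys_iff cong: if_cong)
  have "t = abs_tensors p"
    unfolding p_def by (metis Quotient3_abs_rep[OF Quotient3_tensors])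
  also have "\<dots> = (\<Sum>xs\<in>Poly_Mapping.keys p. Poly_Mapping.lookup p xs *\<^sub>R tensor xs)"
    by (subst *) (simp add: tens_sum tensor.abs_eq)
  also have "\<dots> \<in> span (range tensor)"
    by (intro span_sum span_scale span_base) auto
  finally show ?thesis .
qed

lemma linear_eq_on_tensors:
  assumes "linear f" "linear g" "\<And>xs. f (tensor xs) = g (tensor xs)"
  shows "f t = g t"
  using linear_eq_on[OF assms(1,2) tensor_in_span_range] assms(3) by blast

lemma linear_tensor: "linear (\<lambda>x. tensor (xs @ x # ys))"
  using multilinear_tensor unfolding multilinear_list_def by blast

text \<open>Every \<open>f x\<close> is evaluated on the same representative of \<open>t\<close>, a
  fixed finite weighted sum, so linearity in \<open>x\<close> passes through. This handles the
  entries to which a coproduct is not applied.\<close>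

lemma linear_tens_lift_arg:
  assumes "\<And>xs. linear (\<lambda>x. f x xs)"
  shows "linear (\<lambda>x. tens_lift (f x) t)"
  by (rule linearI)
    (simp_all add: tens_lift_def linear_add[OF assms] linear_cmul[OF assms] scaleR_add_right
      sum.distrib scaleR_sum_right scaleR_left_commute mult.commute)

lemma multilinear_tensor_context: "multilinear_list (\<lambda>ys. tensor (us @ ys @ vs))"
  unfolding multilinear_list_def using linear_tensor[of "us @ _" "_ @ vs"] by simp

text \<open>The first fact fixes a prefix, as \<open>tens_apply_last\<close> does; the second fixes
  a suffix, as \<open>tens_apply_first\<close> does.\<close>

lemmas tens_lift_tensor_append =
  tens_lift_tensor[OF multilinear_tensor_context[of _ "[]", simplified]]
  tens_lift_tensor[OF multilinear_tensor_context[of "[]", simplified]]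

lemmas linear_tens_lift_append =
  linear_tens_lift[OF multilinear_tensor_context[of _ "[]", simplified]]
  linear_tens_lift[OF multilinear_tensor_context[of "[]", simplified]]

lemma tens_lift_tensor_id: "tens_lift tensor t = t"
  by (rule linear_eq_on_tensors[OF linear_tens_lift[OF multilinear_tensor] linear_ident])
    (rule tens_lift_tensor[OF multilinear_tensor])

lemma multilinear_map:
  assumes "linear \<theta>"
  shows "multilinear_list (\<lambda>xs. tensor (map \<theta> xs))"
  unfolding multilinear_list_def
  using linear_compose[OF assms linear_tensor] by (simp add: o_def)

lemma linear_tens_map: "linear \<theta> \<Longrightarrow> linear (tens_map \<theta>)"
  unfolding tens_map_def by (rule linear_tens_lift[OF multilinear_map])

lemma tens_map_tensor: "linear \<theta> \<Longrightarrow> tens_map \<theta> (tensor xs) = tensor (map \<theta> xs)"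
  unfolding tens_map_def by (rule tens_lift_tensor[OF multilinear_map])

lemma multilinear_prod_list: "multilinear_list (prod_list :: 'a::real_algebra_1 list \<Rightarrow> 'a)"
  unfolding multilinear_list_def by (intro allI linearI) (simp_all add: algebra_simps)

lemmas linear_tens_prod = linear_tens_lift[OF multilinear_prod_list, folded tens_prod_def]
lemmas tens_prod_tensor = tens_lift_tensor[OF multilinear_prod_list, folded tens_prod_def]

text \<open>The varying entry is either the last one, where linearity comes from \<open>D\<close>,
  or an earlier one, where \<open>D (last xs)\<close> stays fixed and only the prefix
  varies.\<close>

lemma multilinear_apply_last:
  assumes "linear D"
  shows "multilinear_list (\<lambda>xs. if xs = [] then 0 else
     tens_lift (\<lambda>ys. tensor (butlast xs @ ys)) (D (last xs)))"
  unfolding multilinear_list_def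
proof (intro allI)
  fix xs ys :: "'a list"
  show "linear (\<lambda>x. if xs @ x # ys = [] then 0 else
     tens_lift (\<lambda>zs. tensor (butlast (xs @ x # ys) @ zs)) (D (last (xs @ x # ys))))"
  proof (cases "ys = []")
    case True
    then show ?thesis
      using linear_compose[OF assms linear_tens_lift_append(1)[of xs]] by (simp add: o_def)
  next
    case False
    then show ?thesis
      using linear_tens_lift_arg[OF linear_tensor, of "\<lambda>_. xs" "\<lambda>zs. butlast ys @ zs"]
      by (simp add: butlast_append)
  qed
qed

lemma multilinear_apply_first:
  assumes "linear D"
  shows "multilinear_list (\<lambda>xs. if xs = [] then 0 else
     tens_lift (\<lambda>ys. tensor (ys @ tl xs)) (D (hd xs)))"
  unfolding multilinear_list_def
proof (intro allI)
  fix xs ys :: "'a list"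
  show "linear (\<lambda>x. if xs @ x # ys = [] then 0 else
     tens_lift (\<lambda>zs. tensor (zs @ tl (xs @ x # ys))) (D (hd (xs @ x # ys))))"
  proof (cases xs)
    case Nil
    then show ?thesis
      using linear_compose[OF assms linear_tens_lift_append(2)[of ys]] by (simp add: o_def)
  next
    case (Cons a as)
    then show ?thesis
      using linear_tens_lift_arg[OF linear_tensor, of "\<lambda>zs. zs @ as" "\<lambda>_. ys"] by simp
  qed
qed

lemma linear_apply_last: "linear D \<Longrightarrow> linear (tens_apply_last D)"
  unfolding tens_apply_last_def by (rule linear_tens_lift[OF multilinear_apply_last])

lemma linear_apply_first: "linear D \<Longrightarrow> linear (tens_apply_first D)"
  unfolding tens_apply_first_def by (rule linear_tens_lift[OF multilinear_apply_first])

lemma apply_last_tensor: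
  "linear D \<Longrightarrow> tens_apply_last D (tensor (xs @ [x])) = tens_lift (\<lambda>ys. tensor (xs @ ys)) (D x)"
  unfolding tens_apply_last_def by (simp add: tens_lift_tensor[OF multilinear_apply_last])

lemma apply_last_Nil: "linear D \<Longrightarrow> tens_apply_last D (tensor []) = 0"
  unfolding tens_apply_last_def by (simp add: tens_lift_tensor[OF multilinear_apply_last])

lemma apply_first_tensor:
  "linear D \<Longrightarrow> tens_apply_first D (tensor (x # xs)) = tens_lift (\<lambda>ys. tensor (ys @ xs)) (D x)"
  unfolding tens_apply_first_def by (simp add: tens_lift_tensor[OF multilinear_apply_first])

section \<open>Tensor products of functionals\<close>

text \<open>The value of \<open>f_1 \<otimes> \<dots> \<otimes> f_k\<close> on a pure tensor. Since
  \<open>tensors\<close> contains all orders at once, the functional is extended by 0 to lists of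
  any other length.\<close>

fun pairing :: "('a \<Rightarrow> real) list \<Rightarrow> 'a list \<Rightarrow> real" where
  "pairing [] [] = 1"
| "pairing (f # fs) (x # xs) = f x * pairing fs xs"
| "pairing _ _ = 0"

definition tens_eval :: "('a::real_vector \<Rightarrow> real) list \<Rightarrow> 'a tensors \<Rightarrow> real" where
  "tens_eval fs = tens_lift (pairing fs)"

lemma pairing_append:
  "length fs = length xs \<Longrightarrow> pairing (fs @ gs) (xs @ ys) = pairing fs xs * pairing gs ys"
  by (induction fs xs rule: pairing.induct) auto

lemma pairing_length: "length fs \<noteq> length xs \<Longrightarrow> pairing fs xs = 0"
  by (induction fs xs rule: pairing.induct) auto

lemma multilinear_pairing:
  assumes "\<forall>f\<in>set fs. linear f"
  shows "multilinear_list (pairing fs)"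
  unfolding multilinear_list_def
proof (intro allI)
  fix xs ys
  show "linear (\<lambda>x. pairing fs (xs @ x # ys))"
    using assms
  proof (induction fs arbitrary: xs)
    case Nil
    then show ?case by (cases xs) (auto intro!: linearI)
  next
    case (Cons f fs)
    show ?case
    proof (cases xs)
      case Nil
      have "linear f" using Cons.prems by simp
      then show ?thesis
        unfolding Nil by (auto intro!: linearI simp: linear_add linear_cmul algebra_simps)
    next
      case (Cons a as)
      have l: "linear (\<lambda>x. pairing fs (as @ x # ys))"
        using Cons.IH Cons.prems by simp
      show ?thesis
        unfolding Cons by (rule linearI) (simp_all add: linear_add[OF l] linear_cmul[OF l] algebra_simps)
    qed
  qed
qed

lemma linear_tens_eval: "\<forall>f\<in>set fs. linear f \<Longrightarrow> linear (tens_eval fs)"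
  unfolding tens_eval_def by (rule linear_tens_lift[OF multilinear_pairing])

lemma tens_eval_tensor:
  "\<forall>f\<in>set fs. linear f \<Longrightarrow> tens_eval fs (tensor xs) = pairing fs xs"
  unfolding tens_eval_def by (rule tens_lift_tensor[OF multilinear_pairing])

lemma pairing_map: "pairing fs (map \<theta> xs) = pairing (map (\<lambda>f. f \<circ> \<theta>) fs) xs"
proof (induction fs arbitrary: xs)
  case Nil
  then show ?case by (cases xs) auto
next
  case (Cons f fs)
  then show ?case by (cases xs) auto
qed

text \<open>The transpose of \<open>\<theta> \<otimes> \<dots> \<otimes> \<theta>\<close> acts on
  functionals by precomposition. This is how functionals on the target algebra are pulled back to
  the source.\<close>

lemma tens_eval_tens_map:
  assumes "\<forall>f\<in>set fs. linear f" "linear \<theta>"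
  shows "tens_eval fs (tens_map \<theta> t) = tens_eval (map (\<lambda>f. f \<circ> \<theta>) fs) t"
proof -
  have l: "\<forall>g\<in>set (map (\<lambda>f. f \<circ> \<theta>) fs). linear g"
    using assms by (auto intro: linear_compose)
  have "linear (tens_eval fs \<circ> tens_map \<theta>)"
    by (intro linear_compose linear_tens_map linear_tens_eval assms)
  then show ?thesis
    using linear_eq_on_tensors[OF _ linear_tens_eval[OF l], of _ t]
    by (fastforce simp: tens_map_tensor assms tens_eval_tensor[OF l] tens_eval_tensor pairing_map)
qed

section \<open>Bases of tensor powers\<close>

text \<open>Coordinates default to 0 off the span of \<open>A\<close>. When the span is everything,
  they are linear on the whole type and can serve as entries of \<open>tens_eval\<close>.\<close>

lemma linear_representation_real:
  assumes "independent A" "span A = UNIV"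
  shows "linear (\<lambda>v. representation A v b)"
  by (rule linearI)
    (use assms in \<open>simp_all add: representation_add representation_scale\<close>)

lemma pairing_dual_basis:
  assumes "independent A" "zs \<in> lists A" "ws \<in> lists A"
  shows "pairing (map (\<lambda>z x. representation A x z) zs) ws = (if ws = zs then 1 else 0)"
  using assms(2,3)
proof (induction zs arbitrary: ws)
  case Nil
  then show ?case by (cases ws) auto
next
  case (Cons z zs)
  then show ?case
    by (cases ws) (auto simp: representation_basis[OF assms(1)])
qed

context
  fixes A :: "'a::real_vector set"
  assumes indep: "independent A" and span: "span A = UNIV"
begin

text \<open>Tensor products of coordinate functionals are dual to the pure tensors with entries in
  \<open>A\<close>. Injectivity of \<open>tensor\<close> on \<open>lists A\<close> and independence
  of the image both follow from this.\<close>

lemma tens_eval_dual_basis: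
  assumes "zs \<in> lists A" "ws \<in> lists A"
  shows "tens_eval (map (\<lambda>z x. representation A x z) zs) (tensor ws) = (if ws = zs then 1 else 0)"
  using assms
  by (subst tens_eval_tensor)
    (auto simp: pairing_dual_basis indep intro: linear_representation_real[OF indep span])

lemma inj_on_tensor: "inj_on tensor (lists A)"
  by (rule inj_onI) (metis tens_eval_dual_basis zero_neq_one)

lemma independent_tensor: "independent (tensor ` lists A)"
  unfolding dependent_def
proof (rule notI, elim bexE)
  fix t assume "t \<in> tensor ` lists A" "t \<in> span (tensor ` lists A - {t})"
  then obtain zs where zs: "zs \<in> lists A" and s: "tensor zs \<in> span (tensor ` lists A - {tensor zs})"
    by blast
  let ?f = "tens_eval (map (\<lambda>z x. representation A x z) zs)"
  have "linear ?f"
    by (rule linear_tens_eval) (auto intro: linear_representation_real[OF indep span])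
  then have "?f (tensor zs) = 0"
  proof (rule linear_eq_0_on_span[OF _ _ s])
    fix t assume "t \<in> tensor ` lists A - {tensor zs}"
    then obtain ws where "ws \<in> lists A" "t = tensor ws" "ws \<noteq> zs" by blast
    then show "?f t = 0" using tens_eval_dual_basis[OF zs] by simp
  qed
  then show False
    using tens_eval_dual_basis[OF zs zs] by simp
qed

lemma span_tensor: "span (tensor ` lists A) = UNIV"
proof -
  \<comment> \<open>The entries are expanded in \<open>A\<close> one at a time from the left:
    \<open>bs\<close> holds those already in \<open>A\<close>, and the induction runs over the
    remaining ones.\<close>
  have "tensor (bs @ xs) \<in> span (tensor ` lists A)" if "bs \<in> lists A" for bs xs
    using that
  proof (induction xs arbitrary: bs)
    case Nil
    then show ?case by (auto intro: span_base)
  next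
    case (Cons x xs)
    have "tensor (bs @ b # xs) \<in> span (tensor ` lists A)" if "b \<in> A" for b
      using Cons.IH[of "bs @ [b]"] that Cons.prems by simp
    then have "span ((\<lambda>x. tensor (bs @ x # xs)) ` A) \<subseteq> span (tensor ` lists A)"
      by (intro span_minimal subspace_span) auto
    moreover have "tensor (bs @ x # xs) \<in> span ((\<lambda>x. tensor (bs @ x # xs)) ` A)"
      unfolding linear_span_image[OF linear_tensor] span by blast
    ultimately show ?case by blast
  qed
  from this[of "[]"] have "range tensor \<subseteq> span (tensor ` lists A)" by auto
  then show ?thesis
    using tensor_in_span_range span_minimal[OF _ subspace_span] by blast
qed

lemma representation_tensor:
  assumes "zs \<in> lists A" "ws \<in> lists A"
  shows "representation (tensor ` lists A) (tensor ws) (tensor zs) = (if ws = zs then 1 else 0)"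
  using assms inj_on_tensor
  by (auto simp: representation_basis[OF independent_tensor] inj_on_eq_iff)

end

section \<open>Convolution of functionals\<close>

definition conv :: "('a::real_vector \<Rightarrow> 'a tensors) \<Rightarrow> ('a \<Rightarrow> real) \<Rightarrow> ('a \<Rightarrow> real) \<Rightarrow> 'a \<Rightarrow> real" where
  "conv D f g x = tens_eval [f, g] (D x)"

text \<open>The index is shifted: \<open>conv_power D e k\<close> is the \<open>(k + 1)\<close>-fold convolution of \<open>e\<close>.\<close>

primrec conv_power :: "('a::real_vector \<Rightarrow> 'a tensors) \<Rightarrow> ('a \<Rightarrow> real) \<Rightarrow> nat \<Rightarrow> 'a \<Rightarrow> real" where
  "conv_power D e 0 = e"
| "conv_power D e (Suc k) = conv D e (conv_power D e k)"

lemma linear_conv: "\<lbrakk>linear D; linear f; linear g\<rbrakk> \<Longrightarrow> linear (conv D f g)"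
  using linear_compose[of D "tens_eval [f, g]"] linear_tens_eval[of "[f, g]"]
  by (force simp: conv_def[abs_def] o_def)

lemma linear_conv_power: "\<lbrakk>linear D; linear e\<rbrakk> \<Longrightarrow> linear (conv_power D e k)"
  by (induction k) (auto intro: linear_conv)

section \<open>Homogeneous components, and convolution in a graded connected Hopf algebra\<close>

context graded_connected_hopf_algebra
begin

lemma decomp_ex: "\<exists>f. homogeneous_decomp H x f"
  using direct_sum by blast

lemma decomp_unique: "\<lbrakk>homogeneous_decomp H x f; homogeneous_decomp H x g\<rbrakk> \<Longrightarrow> f = g"
  using direct_sum by blast

text \<open>The index set may be larger than the support. Components can cancel in a sum of
  decompositions, so its exact support is not at hand when linearity of the components is
  checked.\<close>

lemma decomp_superset:
  assumes "finite N" "\<And>n. f n \<in> H n" "\<And>n. n \<notin> N \<Longrightarrow> f n = 0" "x = (\<Sum>n\<in>N. f n)"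
  shows "homogeneous_decomp H x f"
proof -
  have "{n. f n \<noteq> 0} \<subseteq> N" using assms(3) by blast
  then show ?thesis
    unfolding homogeneous_decomp_def using assms(1,2,4)
    by (auto intro: finite_subset sum.mono_neutral_right)
qed

lemma decomp_sum:
  assumes "homogeneous_decomp H x f" "finite N" "{n. f n \<noteq> 0} \<subseteq> N"
  shows "x = (\<Sum>n\<in>N. f n)"
  using assms unfolding homogeneous_decomp_def
  by (auto intro: sum.mono_neutral_left)

definition homogeneous_part :: "nat \<Rightarrow> 'a \<Rightarrow> 'a" where
  "homogeneous_part n x = (THE f. homogeneous_decomp H x f) n"

lemma homogeneous_part_eq: "homogeneous_decomp H x f \<Longrightarrow> homogeneous_part n x = f n"
  unfolding homogeneous_part_def using decomp_unique by (metis the_equality)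

lemma decomp_homogeneous: "x \<in> H n \<Longrightarrow> homogeneous_decomp H x (\<lambda>m. if m = n then x else 0)"
  by (rule decomp_superset[of "{n}"]) (auto intro: subspace_0[OF subspace_H])

lemma homogeneous_part_homogeneous: "x \<in> H n \<Longrightarrow> homogeneous_part m x = (if m = n then x else 0)"
  using homogeneous_part_eq[OF decomp_homogeneous] by simp

lemma linear_homogeneous_part: "linear (homogeneous_part n)"
proof (rule linearI)
  fix x y :: 'a and c :: real
  obtain f g where f: "homogeneous_decomp H x f" and g: "homogeneous_decomp H y g"
    using decomp_ex by blast
  let ?N = "{n. f n \<noteq> 0} \<union> {n. g n \<noteq> 0}"
  have fin: "finite ?N" and mem: "f n \<in> H n" "g n \<in> H n" for n
    using f g unfolding homogeneous_decomp_def by auto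
  have x: "x = (\<Sum>n\<in>?N. f n)" and y: "y = (\<Sum>n\<in>?N. g n)"
    using decomp_sum[OF f fin] decomp_sum[OF g fin] by auto
  have "homogeneous_decomp H (x + y) (\<lambda>n. f n + g n)"
    by (rule decomp_superset[OF fin])
      (use mem x y in \<open>auto simp: sum.distrib intro: subspace_add[OF subspace_H]\<close>)
  then show "homogeneous_part n (x + y) = homogeneous_part n x + homogeneous_part n y"
    using homogeneous_part_eq f g by simp
  have "homogeneous_decomp H (c *\<^sub>R x) (\<lambda>n. c *\<^sub>R f n)"
    by (rule decomp_superset[OF fin])
      (use mem x in \<open>auto simp: scaleR_sum_right intro: subspace_scale[OF subspace_H]\<close>)
  then show "homogeneous_part n (c *\<^sub>R x) = c *\<^sub>R homogeneous_part n x"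
    using homogeneous_part_eq f by simp
qed

text \<open>The counit enters only through the zeroth iterated coproduct, which is evaluated on
  degree 0, where the only basis element is 1.\<close>

lemma counit_one: "counit H 1 = 1"
  unfolding counit_def
proof (rule the_equality)
  have d: "homogeneous_decomp H 1 (\<lambda>m. if m = 0 then 1 else 0)"
    by (rule decomp_homogeneous) (auto simp: connected intro: span_base)
  then show "\<exists>f. homogeneous_decomp H 1 f \<and> f 0 = 1 *\<^sub>R 1"
    by auto
  fix r :: real assume "\<exists>f. homogeneous_decomp H 1 f \<and> f 0 = r *\<^sub>R 1"
  then obtain f where "homogeneous_decomp H 1 f" "f 0 = r *\<^sub>R 1" by blast
  then have "(1 :: 'a) = r *\<^sub>R 1"
    using decomp_unique[OF d] by force
  then show "r = 1"
    by (metis scaleR_cancel_right scaleR_one zero_neq_one)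
qed

text \<open>The type does not record that \<open>D x\<close> is a tensor of order two. The grading
  condition gives this for each homogeneous component, and linearity for \<open>x\<close>.\<close>

lemma D_in_span: "D x \<in> span (range (\<lambda>(v, w). tensor [v, w]))"
proof -
  have hom: "D y \<in> span (range (\<lambda>(v, w). tensor [v, w]))" if "y \<in> H n" for y n
  proof -
    have "(\<Union>j\<in>{0..n}. tens_sub (H j) (H (n - j))) \<subseteq> span (range (\<lambda>(v, w). tensor [v, w]))"
      unfolding tens_sub_def by (intro UN_least span_mono) auto
    from span_minimal[OF this subspace_span] show ?thesis
      using D_graded[OF that] by blast
  qed
  obtain f where "\<And>n. f n \<in> H n" "x = (\<Sum>n | f n \<noteq> 0. f n)"
    using decomp_ex[of x] unfolding homogeneous_decomp_def by blast
  then show ?thesis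
    by (auto simp: linear_sum[OF linear_D] intro: span_sum hom)
qed

lemma linear_eq_on_D:
  assumes "linear f" "linear g" "\<And>v w. f (tensor [v, w]) = g (tensor [v, w])"
  shows "f (D x) = g (D x)"
  by (rule linear_eq_on[OF assms(1,2) D_in_span]) (use assms(3) in auto)

text \<open>Convolution is the transpose of the coproduct: splitting the last entry and then
  evaluating \<open>f\<close> and \<open>g\<close> amounts to evaluating their convolution at that
  entry.\<close>

lemma tens_eval_apply_last:
  assumes "\<forall>k\<in>set fs. linear k" "linear f" "linear g"
  shows "tens_eval (fs @ [f, g]) (tens_apply_last D t) = tens_eval (fs @ [conv D f g]) t"
proof -
  have l1: "\<forall>k\<in>set (fs @ [f, g]). linear k"
    and l2: "\<forall>k\<in>set (fs @ [conv D f g]). linear k"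
    and l3: "\<forall>k\<in>set [f, g]. linear k"
    using assms linear_conv[OF linear_D] by auto
  have "(tens_eval (fs @ [f, g]) \<circ> tens_apply_last D) t = tens_eval (fs @ [conv D f g]) t"
  proof (rule linear_eq_on_tensors)
    show "linear (tens_eval (fs @ [f, g]) \<circ> tens_apply_last D)"
      by (intro linear_compose linear_apply_last linear_D linear_tens_eval l1)
    show "linear (tens_eval (fs @ [conv D f g]))"
      by (intro linear_tens_eval l2)
    fix xs
    show "(tens_eval (fs @ [f, g]) \<circ> tens_apply_last D) (tensor xs)
        = tens_eval (fs @ [conv D f g]) (tensor xs)"
    proof (cases xs rule: rev_cases)
      case Nil
      then show ?thesis
        using linear_0[OF linear_tens_eval[OF l1]]
        by (simp add: apply_last_Nil[OF linear_D] tens_eval_tensor[OF l2] pairing_length)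
    next
      case (snoc ys y)
      \<comment> \<open>The prefix \<open>ys\<close> contributes a constant factor, which is 0 if
        its length differs from that of \<open>fs\<close>. The comparison is made on pairs only: on
        tensors of other orders the total lengths could agree although the prefixes do not
        match.\<close>
      have "(tens_eval (fs @ [f, g]) \<circ> tens_lift (\<lambda>zs. tensor (ys @ zs))) (D y)
          = ((\<lambda>r. (if length fs = length ys then pairing fs ys else 0) * r) \<circ> tens_eval [f, g]) (D y)"
      proof (rule linear_eq_on_D)
        show "linear (tens_eval (fs @ [f, g]) \<circ> tens_lift (\<lambda>zs. tensor (ys @ zs)))"
          by (intro linear_compose linear_tens_lift_append linear_tens_eval l1)
        show "linear ((\<lambda>r. (if length fs = length ys then pairing fs ys else 0) * r) \<circ> tens_eval [f, g])"
          by (intro linear_compose linear_tens_eval l3) (auto intro!: linearI simp: algebra_simps)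
        fix v w
        show "(tens_eval (fs @ [f, g]) \<circ> tens_lift (\<lambda>zs. tensor (ys @ zs))) (tensor [v, w])
          = ((\<lambda>r. (if length fs = length ys then pairing fs ys else 0) * r) \<circ> tens_eval [f, g]) (tensor [v, w])"
          by (simp add: tens_lift_tensor_append tens_eval_tensor[OF l1] tens_eval_tensor[OF l3]
              pairing_append pairing_length)
      qed
      then show ?thesis
        by (simp add: snoc apply_last_tensor[OF linear_D] tens_eval_tensor[OF l2] conv_def
            pairing_append pairing_length)
    qed
  qed
  then show ?thesis by simp
qed

text \<open>Both sides are the value of \<open>f \<otimes> g \<otimes> h\<close> on the three-fold
  coproduct, formed by splitting the first factor on the left and the last factor on the right.
  Coassociativity identifies the two.\<close>

lemma conv_assoc:
  assumes "linear f" "linear g" "linear h"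
  shows "conv D (conv D f g) h = conv D f (conv D g h)"
proof
  fix x
  have l1: "\<forall>k\<in>set [f, g, h]. linear k"
    and l2: "\<forall>k\<in>set [conv D f g, h]. linear k"
    and l3: "\<forall>k\<in>set [f, g]. linear k"
    using assms linear_conv[OF linear_D] by auto
  have "(tens_eval [f, g, h] \<circ> tens_apply_first D) (D x) = tens_eval [conv D f g, h] (D x)"
  proof (rule linear_eq_on_D)
    show "linear (tens_eval [f, g, h] \<circ> tens_apply_first D)"
      by (intro linear_compose linear_apply_first linear_D linear_tens_eval l1)
    show "linear (tens_eval [conv D f g, h])"
      by (intro linear_tens_eval l2)
    fix v w
    have "(tens_eval [f, g, h] \<circ> tens_lift (\<lambda>zs. tensor (zs @ [w]))) (D v)
        = ((\<lambda>r. r * h w) \<circ> tens_eval [f, g]) (D v)"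
    proof (rule linear_eq_on_D)
      show "linear (tens_eval [f, g, h] \<circ> tens_lift (\<lambda>zs. tensor (zs @ [w])))"
        by (intro linear_compose linear_tens_lift_append linear_tens_eval l1)
      show "linear ((\<lambda>r. r * h w) \<circ> tens_eval [f, g])"
        by (intro linear_compose linear_tens_eval l3) (auto intro!: linearI simp: algebra_simps)
      fix p q
      show "(tens_eval [f, g, h] \<circ> tens_lift (\<lambda>zs. tensor (zs @ [w]))) (tensor [p, q])
        = ((\<lambda>r. r * h w) \<circ> tens_eval [f, g]) (tensor [p, q])"
        by (simp add: tens_lift_tensor_append tens_eval_tensor[OF l1] tens_eval_tensor[OF l3])
    qed
    then show "(tens_eval [f, g, h] \<circ> tens_apply_first D) (tensor [v, w])
        = tens_eval [conv D f g, h] (tensor [v, w])"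
      by (simp add: apply_first_tensor[OF linear_D] tens_eval_tensor[OF l2] conv_def)
  qed
  moreover have "tens_eval [f, g, h] (tens_apply_last D (D x)) = tens_eval [f, conv D g h] (D x)"
    using tens_eval_apply_last[of "[f]" g h "D x"] assms by simp
  ultimately show "conv D (conv D f g) h x = conv D f (conv D g h) x"
    by (simp add: conv_def[where f = "conv D f g"] conv_def[where g = "conv D g h"] coassoc)
qed

text \<open>With the shifted index, the numbers of factors are \<open>j + 1\<close> and
  \<open>k + 1\<close>, so the total \<open>j + k + 2\<close> has index
  \<open>Suc (j + k)\<close>.\<close>

lemma conv_power_add:
  assumes "linear e"
  shows "conv D (conv_power D e j) (conv_power D e k) = conv_power D e (Suc (j + k))"
  by (induction j) (simp_all add: conv_assoc assms linear_conv_power linear_D)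

text \<open>Undoing the last coproduct merges the final two functionals into a higher convolution
  power. The index \<open>k\<close> is kept general so that the induction can absorb one more factor
  at each step.\<close>

lemma tens_eval_iter_coprod:
  assumes "linear e"
  shows "tens_eval (replicate m e @ [conv_power D e k]) (iter_coprod H D (Suc m) x)
    = conv_power D e (m + k) x"
proof (induction m arbitrary: k)
  case 0
  then show ?case
    by (simp add: tens_eval_tensor linear_conv_power linear_D assms)
next
  case (Suc m)
  have "replicate (Suc m) e @ [conv_power D e k] = replicate m e @ [e, conv_power D e k]"
    using replicate_append_same[of m e] by simp
  then show ?case
    using Suc[of "Suc k"] assms
    by (simp add: tens_eval_apply_last linear_conv_power linear_D)
qed

section \<open>Degrees in iterated coproducts and Hopf powers\<close>

text \<open>A last factor of degree \<open>d\<close> splits into degrees \<open>j\<close> and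
  \<open>d - j\<close>, so the total degree is preserved at each stage.\<close>

lemma iter_coprod_graded:
  assumes "x \<in> H n"
  shows "iter_coprod H D (Suc a) x
    \<in> span {tensor zs | zs ds. list_all2 (\<lambda>z d. z \<in> H d) zs ds \<and> sum_list ds = n}"
proof (induction a)
  case 0
  have "list_all2 (\<lambda>z d. z \<in> H d) [x] [n] \<and> sum_list [n] = n" using assms by simp
  then have "tensor [x]
    \<in> {tensor zs | zs ds. list_all2 (\<lambda>z d. z \<in> H d) zs ds \<and> sum_list ds = n}"
    by blast
  then show ?case by (simp add: span_base)
next
  case (Suc a)
  let ?T = "{tensor zs | zs ds. list_all2 (\<lambda>z d. z \<in> H d) zs ds \<and> sum_list ds = n}"
  have "tens_apply_last D t \<in> span ?T" if "t \<in> ?T" for t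
  proof -
    from that obtain zs ds where t: "t = tensor zs" "list_all2 (\<lambda>z d. z \<in> H d) zs ds" "sum_list ds = n"
      by blast
    show ?thesis
    proof (cases zs rule: rev_cases)
      case Nil
      then show ?thesis using t by (simp add: apply_last_Nil[OF linear_D] span_zero)
    next
      case (snoc ys y)
      then obtain ds' d where ds: "ds = ds' @ [d]" "list_all2 (\<lambda>z d. z \<in> H d) ys ds'" "y \<in> H d"
        using t(2) by (auto simp: list_all2_append1 list_all2_Cons1)
      let ?S = "{tensor [v, w] | v w j. j \<le> d \<and> v \<in> H j \<and> w \<in> H (d - j)}"
      have "(\<Union>j\<in>{0..d}. tens_sub (H j) (H (d - j))) \<subseteq> span ?S"
        unfolding tens_sub_def by (intro UN_least span_mono) auto
      then have "D y \<in> span ?S"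
        using D_graded[OF ds(3)] span_minimal[OF _ subspace_span] by blast
      then have "tens_lift (\<lambda>zs. tensor (ys @ zs)) (D y)
          \<in> span (tens_lift (\<lambda>zs. tensor (ys @ zs)) ` ?S)"
        by (simp add: linear_span_image[OF linear_tens_lift_append(1)])
      moreover have "tens_lift (\<lambda>zs. tensor (ys @ zs)) ` ?S \<subseteq> ?T"
      proof safe
        fix v w j assume vw: "j \<le> d" "v \<in> H j" "w \<in> H (d - j)"
        have "list_all2 (\<lambda>z d. z \<in> H d) (ys @ [v, w]) (ds' @ [j, d - j]) \<and>
            sum_list (ds' @ [j, d - j]) = n"
          using vw ds t(3) by (auto intro!: list_all2_appendI)
        then show "\<exists>zs ds. tens_lift (\<lambda>zs. tensor (ys @ zs)) (tensor [v, w]) = tensor zs \<and>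
            list_all2 (\<lambda>z d. z \<in> H d) zs ds \<and> sum_list ds = n"
          unfolding tens_lift_tensor_append by blast
      qed
      ultimately have "tens_lift (\<lambda>zs. tensor (ys @ zs)) (D y) \<in> span ?T"
        by (meson span_mono subsetD)
      then show ?thesis
        by (simp only: t(1) snoc apply_last_tensor[OF linear_D])
    qed
  qed
  then have "tens_apply_last D ` ?T \<subseteq> span ?T" by blast
  then have "span (tens_apply_last D ` ?T) \<subseteq> span ?T"
    by (rule span_minimal[OF _ subspace_span])
  then show ?case
    using Suc by (auto simp: linear_span_image[OF linear_apply_last[OF linear_D]])
qed

lemma hopf_power_graded:
  assumes "x \<in> H n" "a \<ge> 1"
  shows "hopf_power H D a x \<in> H n"
proof -
  let ?T = "{tensor zs | zs ds. list_all2 (\<lambda>z d. z \<in> H d) zs ds \<and> sum_list ds = n}"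
  have "prod_list zs \<in> H (sum_list ds)" if "list_all2 (\<lambda>z d. z \<in> H d) zs ds" for zs ds
    using that by induction (auto intro: mult_H simp: connected span_base)
  then have "tens_prod ` ?T \<subseteq> H n"
    by (auto simp: tens_prod_tensor)
  then have "span (tens_prod ` ?T) \<subseteq> H n"
    by (rule span_minimal[OF _ subspace_H])
  moreover obtain b where "a = Suc b" using assms(2) by (cases a) auto
  ultimately show ?thesis
    using iter_coprod_graded[OF assms(1), of b]
    by (auto simp: hopf_power_def linear_span_image[OF linear_tens_prod])
qed

end

section \<open>The rescaling function\<close>

text \<open>This setting fits both the source and the target algebra; the positivity conditions on
  the structure constants are added later, for the source only.\<close>

locale based_hopf_algebra = graded_connected_hopf_algebra H D
  for H :: "nat \<Rightarrow> 'a::real_algebra_1 set" and D :: "'a \<Rightarrow> 'a tensors" +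
  fixes B :: "nat \<Rightarrow> 'a set"
  assumes finite_dim: "finite_dim_pieces H"
    and graded: "graded_basis H B"
begin

abbreviation basis :: "'a set" where "basis \<equiv> \<Union>n. B n"

abbreviation tensor_basis :: "'a tensors set" where "tensor_basis \<equiv> tensor ` lists basis"

lemma B_0: "B 0 = {1}" and independent_B: "independent (B n)" and span_B: "span (B n) = H n"
  using graded unfolding graded_basis_def by auto

lemma B_subset_H: "b \<in> B n \<Longrightarrow> b \<in> H n"
  using span_B span_base by blast

lemma finite_B: "finite (B n)"
proof -
  obtain S where "finite S" "H n = span S"
    using finite_dim unfolding finite_dim_pieces_def by blast
  then show ?thesis
    using independent_span_bound[OF _ independent_B, of S n] span_superset[of "B n"] span_B by auto
qed

text \<open>A common element of two degrees would equal its own component of degree \<open>m\<close>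
  and have that component zero. Hence a basis element has a well-defined degree.\<close>

lemma B_disjoint:
  assumes "b \<in> B m" "b \<in> B n"
  shows "m = n"
proof (rule ccontr)
  assume "m \<noteq> n"
  then have "b = 0"
    using homogeneous_part_homogeneous[OF B_subset_H[OF assms(1)], of m]
      homogeneous_part_homogeneous[OF B_subset_H[OF assms(2)], of m] by simp
  then show False
    using dependent_zero[of "B m"] independent_B assms(1) by blast
qed

text \<open>Projecting a dependency to the degree of \<open>b\<close> kills all terms of other
  degrees and leaves a dependency inside \<open>B n\<close>.\<close>

lemma independent_basis: "independent basis"
  unfolding dependent_def
proof (rule notI, elim bexE)
  fix b assume "b \<in> basis" and s: "b \<in> span (basis - {b})"
  then obtain n where b: "b \<in> B n" by blast
  have "homogeneous_part n ` (basis - {b}) \<subseteq> span (B n - {b})"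
  proof (rule image_subsetI)
    fix c assume "c \<in> basis - {b}"
    then obtain m where "c \<in> B m" "c \<noteq> b" by blast
    then show "homogeneous_part n c \<in> span (B n - {b})"
      using homogeneous_part_homogeneous[OF B_subset_H, of c m n]
      by (auto simp: span_zero intro: span_base)
  qed
  then have "span (homogeneous_part n ` (basis - {b})) \<subseteq> span (B n - {b})"
    by (rule span_minimal[OF _ subspace_span])
  then have "homogeneous_part n b \<in> span (B n - {b})"
    using s by (auto simp: linear_span_image[OF linear_homogeneous_part])
  then show False
    using homogeneous_part_homogeneous[OF B_subset_H[OF b]] independent_B b
    unfolding dependent_def by auto
qed

lemma span_basis: "span basis = UNIV"
proof -
  have "x \<in> span basis" for x
  proof -
    obtain f where f: "\<And>n. f n \<in> H n" "x = (\<Sum>n | f n \<noteq> 0. f n)"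
      using decomp_ex[of x] unfolding homogeneous_decomp_def by blast
    have "f n \<in> span basis" for n
      using f(1)[of n] span_mono[of "B n" basis] by (auto simp flip: span_B)
    then show ?thesis unfolding f(2) by (intro span_sum) auto
  qed
  then show ?thesis by blast
qed

lemmas independent_tensor_basis = independent_tensor[OF independent_basis span_basis]
lemmas span_tensor_basis = span_tensor[OF independent_basis span_basis]
lemmas representation_tensor_basis = representation_tensor[OF independent_basis span_basis]

section \<open>The degree-one functional and its convolution powers\<close>

definition degree_one_sum :: "'a \<Rightarrow> real" where
  "degree_one_sum = construct basis (\<lambda>b. if b \<in> B 1 then 1 else 0)"

lemma linear_degree_one_sum: "linear degree_one_sum"
  unfolding degree_one_sum_def by (rule linear_construct[OF independent_basis])

lemma degree_one_sum_basis: "b \<in> B n \<Longrightarrow> degree_one_sum b = (if n = 1 then 1 else 0)"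
  unfolding degree_one_sum_def using B_disjoint
  by (subst construct_basis[OF independent_basis]) auto

text \<open>This covers homogeneous elements outside the basis, such as images of basis elements in
  degrees where the morphism is not assumed to respect the bases.\<close>

lemma degree_one_sum_homogeneous:
  assumes "x \<in> H n" "n \<noteq> 1"
  shows "degree_one_sum x = 0"
  by (rule linear_eq_0_on_span[OF linear_degree_one_sum, of "B n"])
    (use assms in \<open>auto simp: degree_one_sum_basis span_B\<close>)

lemma pairing_degree_one_sum:
  "zs \<in> lists basis \<Longrightarrow> pairing (replicate n degree_one_sum) zs
    = (if set zs \<subseteq> B 1 \<and> length zs = n then 1 else 0)"
proof (induction n arbitrary: zs)
  case 0
  then show ?case by (cases zs) auto
next
  case (Suc n)
  then show ?case
    using B_disjoint by (cases zs) (auto simp: degree_one_sum_basis)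
qed

text \<open>On a tensor of basis elements the \<open>n\<close>-th tensor power of
  \<open>degree_one_sum\<close> is 1 exactly for words of length \<open>n\<close> in
  \<open>B 1\<close>. It therefore adds up the coordinates that define the rescaling
  function.\<close>

lemma rescaling_eq_tens_eval:
  "rescaling H D B n x = tens_eval (replicate n degree_one_sum) (iter_coprod H D n x)"
proof -
  let ?C = "{cs. set cs \<subseteq> B 1 \<and> length cs = n}"
  have fin: "finite ?C" using finite_lists_length_eq[OF finite_B] .
  have C: "cs \<in> lists basis" if "cs \<in> ?C" for cs using that by auto
  let ?f = "\<lambda>t. \<Sum>cs\<in>?C. representation tensor_basis t (tensor cs)"
  have "?f (iter_coprod H D n x) = tens_eval (replicate n degree_one_sum) (iter_coprod H D n x)"
  proof (rule linear_eq_on[of ?f _ _ tensor_basis])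
    show "linear ?f"
      by (intro linear_compose_sum ballI
          linear_representation_real[OF independent_tensor_basis span_tensor_basis])
    show "linear (tens_eval (replicate n degree_one_sum))"
      by (intro linear_tens_eval) (simp add: linear_degree_one_sum)
    show "iter_coprod H D n x \<in> span tensor_basis" unfolding span_tensor_basis by blast
    fix t assume "t \<in> tensor_basis"
    then obtain zs where zs: "zs \<in> lists basis" and t: "t = tensor zs" by blast
    have "(\<Sum>cs\<in>?C. representation tensor_basis t (tensor cs)) = (\<Sum>cs\<in>?C. if zs = cs then 1 else 0)"
      unfolding t by (intro sum.cong refl representation_tensor_basis C zs)
    also have "\<dots> = pairing (replicate n degree_one_sum) zs"
      unfolding sum.delta'[OF fin] pairing_degree_one_sum[OF zs] by simp
    also have "\<dots> = tens_eval (replicate n degree_one_sum) t"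
      unfolding t by (subst tens_eval_tensor) (auto simp: linear_degree_one_sum)
    finally show "?f t = tens_eval (replicate n degree_one_sum) t" .
  qed
  moreover have "rescaling H D B n x = (\<Sum>cs\<in>?C. representation tensor_basis (iter_coprod H D n x) (tensor cs))"
    unfolding rescaling_def coprod_coeff_def by (rule sum.cong) auto
  ultimately show ?thesis by simp
qed

lemma rescaling_0: "rescaling H D B 0 1 = 1"
  by (simp add: rescaling_eq_tens_eval counit_one tens_eval_tensor)

lemma rescaling_Suc: "rescaling H D B (Suc k) x = conv_power D degree_one_sum k x"
  using tens_eval_iter_coprod[OF linear_degree_one_sum, of k 0 x]
  by (simp add: rescaling_eq_tens_eval replicate_append_same)

lemma coprod_coeff_pair: "coprod_coeff H D B x [w, z] = representation tensor_basis (D x) (tensor [w, z])"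
proof -
  have "tens_apply_last D (tensor [x]) = D x"
    using apply_last_tensor[OF linear_D, of "[]" x] by (simp add: tens_lift_tensor_id)
  then show ?thesis by (simp add: coprod_coeff_def)
qed

text \<open>A nonzero reduced coproduct has a nonzero coordinate at a pair of positive degrees.
  Subtracting \<open>1 \<otimes> x + x \<otimes> 1\<close> does not alter the coordinates of
  \<open>D x\<close> at such pairs.\<close>

lemma coprod_coeff_reduced:
  assumes "n > 1" "x \<in> B n" "D x \<noteq> tensor [1, x] + tensor [x, 1]"
  obtains j w z where "1 \<le> j" "j < n" "w \<in> B j" "z \<in> B (n - j)" "coprod_coeff H D B x [w, z] \<noteq> 0"
proof -
  let ?r = "D x - tensor [1, x] - tensor [x, 1]"
  let ?S = "{tensor [w, z] | w z j. 1 \<le> j \<and> j < n \<and> w \<in> B j \<and> z \<in> B (n - j)}"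
  have S: "?S \<subseteq> tensor_basis" by force
  have "tensor [v, w] \<in> span ?S" if j: "1 \<le> j" "j < n" and v: "v \<in> H j" and w: "w \<in> H (n - j)" for v w j
  proof -
    have *: "tensor [b, w] \<in> span ?S" if "b \<in> B j" for b
    proof -
      have "tensor [b, w] \<in> (\<lambda>w. tensor [b, w]) ` span (B (n - j))" using w span_B by blast
      also have "\<dots> = span ((\<lambda>w. tensor [b, w]) ` B (n - j))"
        using linear_span_image[OF linear_tensor[of "[b]" "[]"]] by simp
      also have "\<dots> \<subseteq> span ?S" using that j by (intro span_mono) blast
      finally show ?thesis .
    qed
    have "tensor [v, w] \<in> (\<lambda>v. tensor [v, w]) ` span (B j)" using v span_B by blast
    also have "\<dots> = span ((\<lambda>v. tensor [v, w]) ` B j)"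
      using linear_span_image[OF linear_tensor[of "[]" "[w]"]] by simp
    also have "\<dots> \<subseteq> span ?S" using * by (intro span_minimal subspace_span) blast
    finally show ?thesis .
  qed
  then have "tens_sub (H j) (H (n - j)) \<subseteq> span ?S" if "j \<in> {1..n - 1}" for j
    unfolding tens_sub_def using that by (intro span_minimal subspace_span) auto
  then have "span (\<Union>j\<in>{1..n - 1}. tens_sub (H j) (H (n - j))) \<subseteq> span ?S"
    by (intro span_minimal subspace_span) blast
  then have r: "?r \<in> span ?S"
    using D_reduced[of n x] assms(1,2) B_subset_H by auto
  \<comment> \<open>As the reduced coproduct lies in the span of \<open>?S\<close>, its coordinates
    outside \<open>?S\<close> vanish, so a nonzero coordinate can be sought inside
    \<open>?S\<close>.\<close>
  have rep: "representation tensor_basis ?r = representation ?S ?r"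
    using representation_extend[OF independent_tensor_basis r S] .
  have "?r \<noteq> 0" using assms(3) by (simp add: algebra_simps)
  then obtain v where v: "representation ?S ?r v \<noteq> 0"
    using sum_nonzero_representation_eq[OF independent_mono[OF independent_tensor_basis S] r]
    by (metis (mono_tags, lifting) empty_Collect_eq sum.empty)
  then have "v \<in> ?S" by (rule representation_ne_zero)
  then obtain w z j where j: "1 \<le> j" "j < n" and w: "w \<in> B j" and z: "z \<in> B (n - j)"
    and vt: "v = tensor [w, z]" by blast
  have "w \<noteq> 1" "z \<noteq> 1" using B_disjoint[of 1 0] w z j B_0 by force+
  moreover have "[1, x] \<in> lists basis" "[x, 1] \<in> lists basis" "[w, z] \<in> lists basis"
    using B_0 assms(2) w z by auto
  ultimately have
    "representation tensor_basis (tensor [1, x]) v = 0" "representation tensor_basis (tensor [x, 1]) v = 0"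
    unfolding vt by (simp_all add: representation_tensor_basis del: in_lists_conv_set lists.Cons Cons_in_lists_iff)
  then have "representation tensor_basis ?r v = representation tensor_basis (D x) v"
    by (simp add: representation_diff[OF independent_tensor_basis] span_tensor_basis)
  then have "coprod_coeff H D B x [w, z] \<noteq> 0"
    using v rep unfolding vt coprod_coeff_pair by simp
  then show thesis using that j w z by blast
qed

end

section \<open>Positivity of the rescaling function on a state space basis\<close>

locale state_space_hopf_algebra = based_hopf_algebra +
  assumes state_space: "state_space_basis H D B"
begin

text \<open>Expanding \<open>D x\<close> in the tensor basis writes the convolution as a sum of
  nonnegative terms. The lower bound is one of these terms, or 0 if its coefficient
  vanishes.\<close>

lemma conv_basis:
  assumes "linear f" "linear g" "\<And>b. b \<in> basis \<Longrightarrow> f b \<ge> 0" "\<And>b. b \<in> basis \<Longrightarrow> g b \<ge> 0"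
    and x: "x \<in> basis"
  shows conv_nonneg: "conv D f g x \<ge> 0"
    and conv_ge: "\<lbrakk>w \<in> basis; z \<in> basis\<rbrakk> \<Longrightarrow> conv D f g x \<ge> coprod_coeff H D B x [w, z] * (f w * g z)"
proof -
  let ?R = "representation tensor_basis (D x)"
  let ?V = "{v. ?R v \<noteq> 0}"
  have lin: "linear (tens_eval [f, g])" using assms by (simp add: linear_tens_eval)
  have fin: "finite ?V" by (rule finite_representation)
  have "(\<Sum>v\<in>?V. ?R v *\<^sub>R v) = D x"
    using sum_nonzero_representation_eq[OF independent_tensor_basis, of "D x"] span_tensor_basis by simp
  then have "conv D f g x = tens_eval [f, g] (\<Sum>v\<in>?V. ?R v *\<^sub>R v)"
    by (simp only: conv_def)
  then have eq: "conv D f g x = (\<Sum>v\<in>?V. ?R v * tens_eval [f, g] v)"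
    by (simp only: linear_sum[OF lin] linear_cmul[OF lin] real_scaleR_def)
  have eval: "tens_eval [f, g] (tensor [w, z]) = f w * g z" for w z
    using assms by (simp add: tens_eval_tensor)
  \<comment> \<open>In order two the coefficient and the values of \<open>f\<close> and
    \<open>g\<close> are nonnegative; on basis tensors of any other order the evaluation is
    0.\<close>
  have nonneg: "?R v * tens_eval [f, g] v \<ge> 0" if "v \<in> ?V" for v
  proof -
    have "v \<in> tensor_basis" using that representation_ne_zero by blast
    then obtain zs where zs: "zs \<in> lists basis" "v = tensor zs" by blast
    show ?thesis
    proof (cases "length zs = 2")
      case True
      then obtain w z where wz: "zs = [w, z]" by (auto simp: numeral_2_eq_2 length_Suc_conv)
      have "w \<in> basis" "z \<in> basis" using zs wz by auto
      moreover have "?R v \<ge> 0"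
        using state_space x \<open>w \<in> basis\<close> \<open>z \<in> basis\<close> coprod_coeff_pair zs(2) wz
        unfolding state_space_basis_def by fastforce
      ultimately show ?thesis
        using assms(3,4) by (simp add: zs(2) wz eval)
    next
      case False
      then show ?thesis using assms zs(2) by (simp add: tens_eval_tensor pairing_length)
    qed
  qed
  show "conv D f g x \<ge> 0" unfolding eq by (rule sum_nonneg[OF nonneg])
  show "conv D f g x \<ge> coprod_coeff H D B x [w, z] * (f w * g z)" if "w \<in> basis" "z \<in> basis"
  proof (cases "tensor [w, z] \<in> ?V")
    case True
    then show ?thesis
      unfolding eq coprod_coeff_pair using member_le_sum[OF True _ fin, of "\<lambda>v. ?R v * tens_eval [f, g] v"]
        nonneg eval by auto
  next
    case False
    then show ?thesis
      using sum_nonneg[of ?V "\<lambda>v. ?R v * tens_eval [f, g] v", OF nonneg]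
      unfolding eq coprod_coeff_pair by simp
  qed
qed

lemma conv_power_nonneg: "x \<in> basis \<Longrightarrow> conv_power D degree_one_sum k x \<ge> 0"
proof (induction k arbitrary: x)
  case 0
  then show ?case by (auto simp: degree_one_sum_basis)
next
  case (Suc k)
  have "degree_one_sum b \<ge> 0" if "b \<in> basis" for b
    using that by (auto simp: degree_one_sum_basis)
  then show ?case
    using Suc by (auto intro!: conv_nonneg linear_conv_power linear_degree_one_sum linear_D)
qed

text \<open>Strong induction on the degree: a positive coefficient at some
  \<open>w \<otimes> z\<close> with both degrees smaller than that of \<open>x\<close> bounds the
  convolution power from below by a product of positive numbers.\<close>

lemma conv_power_pos: "x \<in> B (Suc k) \<Longrightarrow> conv_power D degree_one_sum k x > 0"
proof (induction k arbitrary: x rule: less_induct)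
  case (less k)
  show ?case
  proof (cases k)
    case 0
    then show ?thesis using less.prems by (simp add: degree_one_sum_basis)
  next
    case (Suc k')
    then have "D x \<noteq> tensor [1, x] + tensor [x, 1]"
      using state_space less.prems unfolding state_space_basis_def by auto
    then obtain j w z where j: "1 \<le> j" "j < Suc k" and w: "w \<in> B j" and z: "z \<in> B (Suc k - j)"
      and ne: "coprod_coeff H D B x [w, z] \<noteq> 0"
      using coprod_coeff_reduced[of "Suc k" x] less.prems Suc by auto
    \<comment> \<open>The shifted indices of the \<open>j\<close>-fold and
      \<open>(Suc k - j)\<close>-fold convolutions; together they make up the
      \<open>(k + 1)\<close>-fold one, since \<open>k = Suc (i + l)\<close>.\<close>
    define i l where "i = j - 1" and "l = k - j"
    have il: "j = Suc i" "Suc k - j = Suc l" "k = Suc (i + l)" using j Suc by (auto simp: i_def l_def)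
    have "coprod_coeff H D B x [w, z] \<ge> 0"
      using state_space less.prems w z unfolding state_space_basis_def by blast
    then have "0 < coprod_coeff H D B x [w, z]
        * (conv_power D degree_one_sum i w * conv_power D degree_one_sum l z)"
      using less.IH[of i w] less.IH[of l z] w z il ne by (auto intro!: mult_pos_pos)
    also have "\<dots> \<le> conv D (conv_power D degree_one_sum i) (conv_power D degree_one_sum l) x"
      using w z less.prems
      by (intro conv_ge conv_power_nonneg linear_conv_power linear_degree_one_sum linear_D) auto
    also have "\<dots> = conv_power D degree_one_sum k x"
      using conv_power_add[OF linear_degree_one_sum] il by simp
    finally show ?thesis .
  qed
qed

lemma rescaling_pos: "x \<in> B n \<Longrightarrow> rescaling H D B n x > 0"
  by (cases n) (auto simp: rescaling_0 rescaling_Suc conv_power_pos B_0)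

end

section \<open>The Hopf-power Markov chain\<close>

context based_hopf_algebra
begin

text \<open>Comparing coordinates in \<open>B n\<close> determines the matrix there, as the
  rescaling factors are nonzero and can be cancelled. The value 0 elsewhere makes it unique as a
  total function, so the \<open>THE\<close> is well defined.\<close>

lemma hopf_power_chain_eq:
  assumes pos: "\<And>x. x \<in> B n \<Longrightarrow> rescaling H D B n x > 0" and "a \<ge> 1"
    and x: "x \<in> B n" and y: "y \<in> B n"
  shows "hopf_power_chain H D B a n x y = rescaling H D B n y / rescaling H D B n x
    * representation (B n) (inverse (real a ^ n) *\<^sub>R hopf_power H D a x) y"
proof -
  let ?r = "rescaling H D B n"
  let ?v = "\<lambda>x. inverse (real a ^ n) *\<^sub>R hopf_power H D a x"
  let ?P = "\<lambda>K. (\<forall>x y. x \<notin> B n \<or> y \<notin> B n \<longrightarrow> K x y = 0) \<and>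
     (\<forall>x\<in>B n. ?v x = (\<Sum>y\<in>B n. (?r x / ?r y * K x y) *\<^sub>R y))"
  define K where "K x y = (if x \<in> B n \<and> y \<in> B n
     then ?r y / ?r x * representation (B n) (?v x) y else 0)" for x y
  have span: "?v x \<in> span (B n)" if "x \<in> B n" for x
    unfolding span_B using that assms(2)
    by (intro subspace_scale[OF subspace_H] hopf_power_graded B_subset_H)
  have "hopf_power_chain H D B a n = K"
    unfolding hopf_power_chain_def
  proof (rule the_equality)
    have "(\<Sum>y\<in>B n. (?r x / ?r y * K x y) *\<^sub>R y) = ?v x" if x: "x \<in> B n" for x
    proof -
      have "(\<Sum>y\<in>B n. (?r x / ?r y * K x y) *\<^sub>R y) = (\<Sum>y\<in>B n. representation (B n) (?v x) y *\<^sub>R y)"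
      proof (rule sum.cong[OF refl])
        fix y assume y: "y \<in> B n"
        then have "?r x \<noteq> 0" "?r y \<noteq> 0" using pos x by fastforce+
        then show "(?r x / ?r y * K x y) *\<^sub>R y = representation (B n) (?v x) y *\<^sub>R y"
          by (simp only: K_def x y simp_thms if_True) (simp add: field_simps)
      qed
      then show ?thesis
        using sum_representation_eq[OF independent_B span[OF x] finite_B] by auto
    qed
    then show "?P K" by (simp add: K_def)
  next
    fix K' assume K': "?P K'"
    have "K' x y = K x y" for x y
    proof (cases "x \<in> B n \<and> y \<in> B n")
      case True
      then have x: "x \<in> B n" and y: "y \<in> B n" by auto
      have ne: "?r x \<noteq> 0" "?r y \<noteq> 0" using pos x y by fastforce+
      have "?v x = (\<Sum>b\<in>B n. (?r x / ?r b * K' x b) *\<^sub>R b)" using K' x by blast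
      then have "representation (B n) (?v x) y
          = representation (B n) (\<Sum>b\<in>B n. (?r x / ?r b * K' x b) *\<^sub>R b) y" by simp
      also have "\<dots> = (\<Sum>b\<in>B n. (?r x / ?r b * K' x b) * (if y = b then 1 else 0))"
        by (simp add: representation_sum[OF independent_B] representation_scale[OF independent_B]
            representation_basis[OF independent_B] span_base span_scale)
      also have "\<dots> = ?r x / ?r y * K' x y"
        using y finite_B by (simp add: if_distrib cong: if_cong)
      finally show ?thesis using ne True by (simp add: K_def)
    next
      case False
      then show ?thesis using K' unfolding K_def by auto
    qed
    then show "K' = K" by blast
  qed
  then show ?thesis using x y by (simp add: K_def)
qed

end

section \<open>Hopf morphisms\<close>

text \<open>Compatibility with a single coproduct is applied to the last factor at each stage. The
  induction starts from order one, where both sides are \<open>tensor [\<theta> x]\<close>.\<close>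

lemma iter_coprod_morphism:
  assumes "hopf_morphism H D H' D' \<theta>" "linear D" "linear D'"
  shows "iter_coprod H' D' (Suc a) (\<theta> x) = tens_map \<theta> (iter_coprod H D (Suc a) x)"
proof (induction a)
  case 0
  then show ?case using assms by (simp add: hopf_morphism_def tens_map_tensor)
next
  case (Suc a)
  have th: "linear \<theta>" and D': "D' (\<theta> y) = tens_map \<theta> (D y)" for y
    using assms(1) unfolding hopf_morphism_def by auto
  have "(tens_apply_last D' \<circ> tens_map \<theta>) t = (tens_map \<theta> \<circ> tens_apply_last D) t" for t
  proof (rule linear_eq_on_tensors[of "tens_apply_last D' \<circ> tens_map \<theta>"
        "tens_map \<theta> \<circ> tens_apply_last D"])
    fix xs
    show "(tens_apply_last D' \<circ> tens_map \<theta>) (tensor xs) = (tens_map \<theta> \<circ> tens_apply_last D) (tensor xs)"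
    proof (cases xs rule: rev_cases)
      case Nil
      then show ?thesis
        using assms th by (simp add: tens_map_tensor apply_last_Nil linear_0[OF linear_tens_map])
    next
      case (snoc ys y)
      have "(tens_lift (\<lambda>zs. tensor (map \<theta> ys @ zs)) \<circ> tens_map \<theta>) (D y)
          = (tens_map \<theta> \<circ> tens_lift (\<lambda>zs. tensor (ys @ zs))) (D y)"
      proof (rule linear_eq_on_tensors[of
            "tens_lift (\<lambda>zs. tensor (map \<theta> ys @ zs)) \<circ> tens_map \<theta>"
            "tens_map \<theta> \<circ> tens_lift (\<lambda>zs. tensor (ys @ zs))"])
        fix zs
        show "(tens_lift (\<lambda>zs. tensor (map \<theta> ys @ zs)) \<circ> tens_map \<theta>) (tensor zs)
          = (tens_map \<theta> \<circ> tens_lift (\<lambda>zs. tensor (ys @ zs))) (tensor zs)"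
          by (simp add: tens_map_tensor[OF th] tens_lift_tensor_append)
      qed (intro linear_compose linear_tens_map linear_tens_lift_append th)+
      then show ?thesis
        using assms th by (simp add: snoc tens_map_tensor apply_last_tensor D')
    qed
  qed (intro linear_compose linear_tens_map linear_apply_last assms th)+
  then show ?case using Suc by simp
qed

lemma hopf_power_morphism:
  assumes "hopf_morphism H D H' D' \<theta>" "linear D" "linear D'" "a \<ge> 1"
  shows "hopf_power H' D' a (\<theta> x) = \<theta> (hopf_power H D a x)"
proof -
  have th: "linear \<theta>" "\<theta> 1 = 1" "\<theta> w * \<theta> z = \<theta> (w * z)" for w z
    using assms(1) unfolding hopf_morphism_def by auto
  have prod: "prod_list (map \<theta> xs) = \<theta> (prod_list xs)" for xs
    by (induction xs) (simp_all add: th)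
  have "(tens_prod \<circ> tens_map \<theta>) t = (\<theta> \<circ> tens_prod) t" for t
  proof (rule linear_eq_on_tensors[of "tens_prod \<circ> tens_map \<theta>" "\<theta> \<circ> tens_prod"])
    fix xs
    show "(tens_prod \<circ> tens_map \<theta>) (tensor xs) = (\<theta> \<circ> tens_prod) (tensor xs)"
      by (simp add: tens_map_tensor th prod tens_prod_tensor)
  qed (intro linear_compose linear_tens_map linear_tens_prod th)+
  moreover obtain b where "a = Suc b" using assms(4) by (cases a) auto
  ultimately show ?thesis
    unfolding hopf_power_def using iter_coprod_morphism[OF assms(1-3)] by simp
qed

text \<open>Moving \<theta> from the iterated coproduct to the functionals reduces the claim to the
  identity \<open>e\<close> for the two degree-one functionals. In degree 0 both rescaling values
  are 1.\<close>

lemma rescaling_morphism: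
  assumes "based_hopf_algebra H D B" "based_hopf_algebra H' D' B'"
    and mor: "hopf_morphism H D H' D' \<theta>" and deg1: "\<theta> ` B 1 \<subseteq> B' 1" and x: "x \<in> B n"
  shows "rescaling H' D' B' n (\<theta> x) = rescaling H D B n x"
proof -
  interpret A: based_hopf_algebra H D B by fact
  interpret A': based_hopf_algebra H' D' B' by fact
  have th: "linear \<theta>" "\<theta> 1 = 1" "\<And>n y. y \<in> H n \<Longrightarrow> \<theta> y \<in> H' n"
    using mor unfolding hopf_morphism_def by blast+
  have e: "A'.degree_one_sum \<circ> \<theta> = A.degree_one_sum"
  proof
    fix y
    show "(A'.degree_one_sum \<circ> \<theta>) y = A.degree_one_sum y"
    proof (rule linear_eq_on[of "A'.degree_one_sum \<circ> \<theta>" _ _ A.basis])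
      show "y \<in> span A.basis" unfolding A.span_basis by blast
      fix b assume "b \<in> A.basis"
      then obtain m where b: "b \<in> B m" by blast
      \<comment> \<open>In degree 1 both values are 1. In any other degree, preservation of degree
        alone forces both to vanish.\<close>
      show "(A'.degree_one_sum \<circ> \<theta>) b = A.degree_one_sum b"
      proof (cases "m = 1")
        case True
        then have "\<theta> b \<in> B' 1" using b deg1 by blast
        then show ?thesis
          using A'.degree_one_sum_basis A.degree_one_sum_basis[OF b] True by simp
      next
        case False
        then show ?thesis
          using A'.degree_one_sum_homogeneous[OF th(3)[OF A.B_subset_H[OF b]]]
            A.degree_one_sum_basis[OF b] by simp
      qed
    qed (intro linear_compose A.linear_degree_one_sum A'.linear_degree_one_sum th)+
  qed
  show ?thesis
  proof (cases n)
    case 0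
    then show ?thesis using x A.B_0 th(2) A.rescaling_0 A'.rescaling_0 by simp
  next
    case (Suc k)
    show ?thesis
      unfolding A.rescaling_eq_tens_eval A'.rescaling_eq_tens_eval Suc
        iter_coprod_morphism[OF mor A.linear_D A'.linear_D]
      by (subst tens_eval_tens_map)
        (simp_all add: A'.linear_degree_one_sum th e del: iter_coprod.simps)
  qed
qed

section \<open>Comparison of coordinates along the fibres of \<theta>\<close>

theorem theorem4p7p1:
  fixes H :: "nat \<Rightarrow> 'h::real_algebra_1 set" and D :: "'h \<Rightarrow> 'h tensors"
    and H' :: "nat \<Rightarrow> 'k::real_algebra_1 set" and D' :: "'k \<Rightarrow> 'k tensors"
    and B :: "nat \<Rightarrow> 'h set" and B' :: "nat \<Rightarrow> 'k set"
    and \<theta> :: "'h \<Rightarrow> 'k" and a n :: nat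
  assumes "graded_connected_hopf_algebra H D" and "finite_dim_pieces H"
    and "graded_connected_hopf_algebra H' D'" and "finite_dim_pieces H'"
    and "graded_basis H B" and "graded_basis H' B'"
    and "state_space_basis H D B"
    and "hopf_morphism H D H' D' \<theta>"
    and "\<theta> ` B n = B' n" and "\<theta> ` B 1 \<subseteq> B' 1"
    and "a \<ge> 1"
  shows "\<forall>x\<in>B n. \<forall>y'\<in>B' n.
           (\<Sum>y | y \<in> B n \<and> \<theta> y = y'. hopf_power_chain H D B a n x y)
             = hopf_power_chain H' D' B' a n (\<theta> x) y'"
proof (intro ballI)
  fix x y' assume x: "x \<in> B n" and y': "y' \<in> B' n"
  interpret A: state_space_hopf_algebra H D B
    using assms by (auto intro!: state_space_hopf_algebra.intro based_hopf_algebra.intro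
        based_hopf_algebra_axioms.intro state_space_hopf_algebra_axioms.intro)
  interpret A': based_hopf_algebra H' D' B'
    using assms by (auto intro!: based_hopf_algebra.intro based_hopf_algebra_axioms.intro)
  let ?\<eta> = "rescaling H D B n" and ?\<eta>' = "rescaling H' D' B' n"
  let ?v = "inverse (real a ^ n) *\<^sub>R hopf_power H D a x"
  let ?c = "representation (B n) ?v"
  have th: "linear \<theta>" using assms(8) unfolding hopf_morphism_def by blast
  have \<theta>: "\<theta> y \<in> B' n" if "y \<in> B n" for y using that assms(9) by blast
  have resc: "?\<eta>' (\<theta> y) = ?\<eta> y" if "y \<in> B n" for y
    by (rule rescaling_morphism[OF A.based_hopf_algebra_axioms A'.based_hopf_algebra_axioms
          assms(8,10) that])
  have pos': "?\<eta>' z > 0" if "z \<in> B' n" for z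
  proof -
    have "z \<in> \<theta> ` B n" using that assms(9) by simp
    then obtain y where "y \<in> B n" "z = \<theta> y" by blast
    then show ?thesis using resc A.rescaling_pos by simp
  qed
  have span: "?v \<in> span (B n)"
    unfolding A.span_B
    by (intro subspace_scale[OF A.subspace_H] A.hopf_power_graded A.B_subset_H x assms)
  have "inverse (real a ^ n) *\<^sub>R hopf_power H' D' a (\<theta> x) = \<theta> ?v"
    using hopf_power_morphism[OF assms(8) A.linear_D A'.linear_D assms(11)]
    by (simp add: linear_cmul[OF th])
  also have "\<dots> = \<theta> (\<Sum>y\<in>B n. ?c y *\<^sub>R y)"
    using sum_representation_eq[OF A.independent_B span A.finite_B] by simp
  also have "\<dots> = (\<Sum>y\<in>B n. ?c y *\<^sub>R \<theta> y)"
    by (simp add: linear_sum[OF th] linear_cmul[OF th])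
  \<comment> \<open>Each \<open>\<theta> y\<close> is itself a basis vector, so its coefficient
    counts exactly when \<open>\<theta> y = y'\<close>. Several \<open>y\<close> may share an image,
    whence the sum over the fibre.\<close>
  finally have "representation (B' n) (inverse (real a ^ n) *\<^sub>R hopf_power H' D' a (\<theta> x)) y'
      = (\<Sum>y\<in>B n. ?c y * (if y' = \<theta> y then 1 else 0))"
    by (simp add: representation_sum[OF A'.independent_B] representation_scale[OF A'.independent_B]
        representation_basis[OF A'.independent_B] \<theta> span_base span_scale)
  also have "\<dots> = (\<Sum>y | y \<in> B n \<and> \<theta> y = y'. ?c y)"
    by (rule sum.mono_neutral_cong_right) (auto simp: A.finite_B)
  finally have "hopf_power_chain H' D' B' a n (\<theta> x) y'
      = ?\<eta>' y' / ?\<eta>' (\<theta> x) * (\<Sum>y | y \<in> B n \<and> \<theta> y = y'. ?c y)"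
    using A'.hopf_power_chain_eq[OF pos' assms(11) \<theta>[OF x] y'] by simp
  \<comment> \<open>On the fibre over \<open>y'\<close> the factor
    \<open>?\<eta>' y' / ?\<eta>' (\<theta> x)\<close> equals \<open>?\<eta> y / ?\<eta> x\<close>,
    so inside the sum it turns each coefficient into a transition probability from \<open>x\<close>
    to \<open>y\<close>.\<close>
  also have "\<dots> = (\<Sum>y | y \<in> B n \<and> \<theta> y = y'. hopf_power_chain H D B a n x y)"
    unfolding sum_distrib_left
    by (rule sum.cong)
      (auto simp: A.hopf_power_chain_eq[OF A.rescaling_pos assms(11) x] resc x)
  finally show "(\<Sum>y | y \<in> B n \<and> \<theta> y = y'. hopf_power_chain H D B a n x y)
      = hopf_power_chain H' D' B' a n (\<theta> x) y'" ..
qed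

end
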